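(* For odd positive $k$, let $F_k:\mathbb{N}\to\mathbb{N}$ be given by $F_k(n)=\frac{3n+k}{2}$ if $n$ is odd and $F_k(n)=\frac{n}{2}$ if $n$ is even. For every positive integer $L$ there exists an odd positive integer $k$ such that $F_k$ has more than $L$ distinct cycles.
   Context: A cycle of $F_k$ is a set $\{x,F_k(x),\dots,F_k^{p-1}(x)\}$ with $x\in\mathbb{N}$, $p\ge1$, $F_k^p(x)=x$. *)

theory Defs
  imports Main
begin

text \<open>
  For odd \<open>k\<close> both divisions by \<open>2\<close> are exact, so \<open>div\<close> agrees with the rational quotient.
\<close>

definition F :: "nat \<Rightarrow> nat \<Rightarrow> nat" where
  "F k n = (if odd n then (3 * n + k) div 2 else n div 2)"

text \<open>
  A cycle is the set of points of a periodic orbit, so two cycles are distinct iff they differ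
  as sets. The starting point is a positive integer, which excludes the trivial cycle \<open>{0}\<close>;
  for \<open>k > 0\<close> this is the only cycle that the restriction excludes.
\<close>

definition is_cycle :: "nat \<Rightarrow> nat set \<Rightarrow> bool" where
  "is_cycle k C \<longleftrightarrow>
     (\<exists>x p. x \<ge> 1 \<and> p \<ge> 1 \<and> (F k ^^ p) x = x \<and> C = {(F k ^^ i) x |i. i < p})"

end

theory Submission
  imports Defs
begin

text \<open>
  For \<open>k = 2 ^ l - 3\<close> with \<open>l \<ge> 2\<close> the powers \<open>1, 2, \<dots>, 2 ^ (l - 1)\<close> form a cycle, because
  \<open>F k 1 = 2 ^ (l - 1)\<close>. Multiplication by an odd \<open>m\<close> maps a cycle for \<open>k\<close> to one for \<open>m * k\<close>,
  so the product of the numbers \<open>2 ^ l - 3\<close> over \<open>L + 1\<close> values of \<open>l\<close> has a cycle with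
  exactly \<open>l\<close> elements for each of these \<open>l\<close>.
\<close>

lemma F_even: "F k (2 * n) = n"
  by (simp add: F_def)

lemma funpow_F_power_of_two:
  assumes "i < l"
  shows "(F k ^^ i) (m * 2 ^ (l - 1)) = m * 2 ^ (l - 1 - i)"
  using assms
proof (induction i)
  case (Suc i)
  then have "m * 2 ^ (l - 1 - i) = 2 * (m * 2 ^ (l - 1 - Suc i))"
    by (metis Suc_diff_Suc Suc_lessE diff_Suc_1 mult.left_commute power_Suc Suc_less_eq)
  then have "F k (m * 2 ^ (l - 1 - i)) = m * 2 ^ (l - 1 - Suc i)"
    by (simp only: F_even)
  then show ?case
    using Suc by simp
qed simp

text \<open>From the top element \<open>m * 2 ^ (l - 1)\<close>, \<open>l - 1\<close> halvings lead
  down to \<open>m\<close>; the odd step then returns to the top, since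
  \<open>3 * m + k = m * 2 ^ l\<close>.\<close>

lemma is_cycle_powers_of_two:
  assumes "l \<ge> 2" and "odd m"
  shows "is_cycle (m * (2 ^ l - 3)) ((\<lambda>i. m * 2 ^ i) ` {..<l})"
proof -
  let ?k = "m * (2 ^ l - 3)" and ?x = "m * 2 ^ (l - 1)"
  \<comment> \<open>This keeps the natural subtraction \<open>2 ^ l - 3\<close> from
    truncating.\<close>
  have "(4::nat) \<le> 2 ^ l"
    using power_increasing[OF assms(1), of "2::nat"] by simp
  then have "3 + (2 ^ l - 3) = (2 ^ l :: nat)"
    by simp
  then have "3 * m + ?k = m * 2 ^ l"
    by (metis distrib_left mult.commute)
  also have "\<dots> = 2 * ?x"
    using assms(1) by (cases l) auto
  finally have Fm: "F ?k m = ?x"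
    using assms(2) by (simp add: F_def)
  have "(F ?k ^^ l) ?x = F ?k ((F ?k ^^ (l - 1)) ?x)"
    using assms(1) by (cases l) auto
  also have "\<dots> = ?x"
    using assms(1) Fm funpow_F_power_of_two[of "l - 1" l ?k m] by simp
  finally have period: "(F ?k ^^ l) ?x = ?x" .
  \<comment> \<open>The orbit runs through the exponents downwards, so the index is
    reflected.\<close>
  have "(\<lambda>i. l - 1 - i) ` {..<l} = {..<l}"
    using assms(1)
    by (intro endo_inj_surj) (auto intro!: inj_onI)
  then have "(\<lambda>i. m * 2 ^ i) ` {..<l} = (\<lambda>i. m * 2 ^ (l - 1 - i)) ` {..<l}"
    by (metis image_image)
  also have "\<dots> = (\<lambda>i. (F ?k ^^ i) ?x) ` {..<l}"
    by (intro image_cong refl) (simp only: funpow_F_power_of_two lessThan_iff)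
  finally have "(\<lambda>i. m * 2 ^ i) ` {..<l} = {(F ?k ^^ i) ?x |i. i < l}"
    by blast
  moreover have "?x \<ge> 1" "l \<ge> 1"
    using assms by (auto simp: Suc_le_eq odd_pos)
  ultimately show ?thesis
    unfolding is_cycle_def using period by blast
qed

theorem theorem10:
  fixes L :: nat
  assumes "L \<ge> 1"
  shows "\<exists>k::nat. odd k \<and> k > 0 \<and>
           (\<exists>\<C>. finite \<C> \<and> card \<C> > L \<and> (\<forall>C\<in>\<C>. is_cycle k C))"
proof -
  define I where "I = {2..L + 2}"
  define k where "k = (\<Prod>l\<in>I. 2 ^ l - 3 :: nat)"
  \<comment> \<open>The cofactor of \<open>2 ^ l - 3\<close> in \<open>k\<close>, used as the
    scaling factor of the \<open>l\<close>-th cycle.\<close>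
  define m where "m l = (\<Prod>j\<in>I - {l}. 2 ^ j - 3 :: nat)" for l
  define C where "C l = (\<lambda>i. m l * 2 ^ i) ` {..<l}" for l
  have "odd (2 ^ l - 3 :: nat)" if "l \<in> I" for l
    using that power_increasing[of 2 l "2::nat"] by (simp add: I_def)
  then have odd_prod: "odd (\<Prod>l\<in>J. 2 ^ l - 3 :: nat)" if "J \<subseteq> I" for J
    using that finite_subset[OF that] by (subst even_prod_iff) (auto simp: I_def)
  have odd_m: "odd (m l)" for l
    unfolding m_def by (rule odd_prod) auto
  have odd_k: "odd k"
    unfolding k_def by (rule odd_prod) auto
  have "k = m l * (2 ^ l - 3)" if "l \<in> I" for l
    unfolding k_def m_def using that
    by (subst prod.remove[of I l]) (simp_all add: I_def mult.commute)
  then have cycle: "is_cycle k (C l)" if "l \<in> I" for l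
    using that is_cycle_powers_of_two[of l "m l"] odd_m by (simp add: C_def I_def)
  have "card (C l) = l" for l
  proof -
    have "inj_on (\<lambda>i. m l * 2 ^ i) {..<l}"
      using odd_pos[OF odd_m[of l]] by (auto intro!: inj_onI)
    then show ?thesis
      by (simp add: C_def card_image)
  qed
  \<comment> \<open>Different \<open>l\<close> give cycles of different size, hence different
    sets.\<close>
  then have "inj_on C I"
    by (metis inj_onI)
  then have "card (C ` I) > L"
    by (simp add: card_image I_def)
  moreover have "finite (C ` I)"
    by (simp add: I_def)
  ultimately show ?thesis
    using odd_k odd_pos[OF odd_k] cycle by blast
qed

end
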